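(* For every positive integer $n$, the $n\times n$ matrix $\mathfrak B=[\mathfrak w(i+j)]_{i,j=0}^{n-1}$ is totally positive.
   Context: Here $\mathfrak w(m)$ is the $m$th Bell number: $\mathfrak w(m)=\sum_{k=0}^{m}S(m,k)$ is the number of partitions of a set of $m$ objects, where $S(m,k)$ are the Stirling numbers of second kind (so $\mathfrak w(0)=1$). A matrix is called totally positive if all its minors are (strictly) positive. *)

theory Defs
  imports
    "HOL-Combinatorics.Stirling"
    "Jordan_Normal_Form.Determinant"
    "Jordan_Normal_Form.DL_Submatrix"
begin

definition bell :: "nat \<Rightarrow> nat" where
  "bell m = (\<Sum>k\<le>m. Stirling m k)"

text \<open>Total positivity in the strict sense: every minor, given by equally many rows \<open>I\<close> and
  columns \<open>J\<close>, is positive. The matrix need not be square.\<close>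

definition totally_positive :: "'a :: linordered_idom mat \<Rightarrow> bool" where
  "totally_positive A \<longleftrightarrow>
     (\<forall>I J. I \<noteq> {} \<and> I \<subseteq> {..<dim_row A} \<and> J \<subseteq> {..<dim_col A} \<and> card I = card J \<longrightarrow>
        det (submatrix A I J) > 0)"

definition bell_matrix :: "nat \<Rightarrow> real mat" where
  "bell_matrix n = mat n n (\<lambda>(i, j). real (bell (i + j)))"

end

theory Submission
  imports Defs Complex_Main "HOL-Library.FuncSet"
begin

text \<open>
  Dobinski's formula \<open>bell m = e\<^sup>-\<^sup>1 \<Sum>\<^sub>k k\<^sup>m / k!\<close> exhibits the Bell numbers as the moments of a
  positive measure on the natural numbers, the Poisson distribution with mean 1. A minor of
  order \<open>n\<close> of the Bell matrix with rows \<open>a\<^sub>0 < a\<^sub>1 < \<dots>\<close> and columns \<open>b\<^sub>0 < b\<^sub>1 < \<dots>\<close> is therefore the determinant of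
  the sums \<open>\<Sum>\<^sub>k w\<^sub>k k\<^bsup>a i\<^esup> k\<^bsup>b j\<^esup>\<close> with weights \<open>w\<^sub>k > 0\<close>.

  Andreief's identity (\<open>andreief_identity\<close>, the Cauchy-Binet formula in a form that sums over all
  tuples of nodes instead of all sets of nodes) turns such a determinant, for a sum over finitely
  many nodes, into a sum over tuples \<open>x\<close> of a positive weight times
  \<open>det(x\<^sub>i\<^bsup>a j\<^esup>) \<cdot> det(x\<^sub>i\<^bsup>b j\<^esup>)\<close>. Sorting the tuple changes both factors by the same sign, and
  for increasing nodes both are generalized Vandermonde determinants, which are nonnegative, and
  positive if the nodes are positive (\<open>alternant_powers_pos\<close>). So every term is nonnegative, and the
  term of the nodes \<open>1, 2, \<dots>, n\<close> is positive.

  Truncating Dobinski's series at \<open>N\<close> thus gives determinants that converge to the minor and, for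
  large \<open>N\<close>, are bounded below by this one positive term, which does not depend on \<open>N\<close>. Hence
  the limit is positive, and not merely nonnegative.
\<close>

section \<open>Alternants\<close>

definition alternant :: "nat \<Rightarrow> (nat \<Rightarrow> 'b \<Rightarrow> 'a :: comm_ring_1) \<Rightarrow> (nat \<Rightarrow> 'b) \<Rightarrow> 'a" where
  "alternant n f x = det (mat n n (\<lambda>(i, j). f j (x i)))"

lemma alternant_expand:
  "alternant n f x =
     (\<Sum>p | p permutes {0..<n}. signof p * (\<Prod>i = 0..<n. f (p i) (x i)))"
proof -
  have "alternant n f x = (\<Sum>p | p permutes {0..<n}.
      signof p * (\<Prod>i = 0..<n. mat n n (\<lambda>(i, j). f j (x i)) $$ (i, p i)))"
    unfolding alternant_def by (rule det_def') simp
  also have "\<dots> = (\<Sum>p | p permutes {0..<n}. signof p * (\<Prod>i = 0..<n. f (p i) (x i)))"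
    by (intro sum.cong refl arg_cong2[where f = "(*)"] prod.cong)
       (auto dest: permutes_in_image[THEN iffD2])
  finally show ?thesis .
qed

text \<open>The Leibniz formula of the transposed matrix, in which the permutation acts on the nodes.\<close>

lemma alternant_expand_rows:
  "alternant n f x =
     (\<Sum>p | p permutes {0..<n}. signof p * (\<Prod>j = 0..<n. f j (x (p j))))"
proof -
  have "alternant n f x = (\<Sum>p | p permutes {0..<n}.
      signof p * (\<Prod>j<n. mat n n (\<lambda>(i, j). f j (x i)) $$ (p j, j)))"
    unfolding alternant_def by (rule det_col) simp
  also have "\<dots> = (\<Sum>p | p permutes {0..<n}. signof p * (\<Prod>j = 0..<n. f j (x (p j))))"
    unfolding atLeast0LessThan
    by (intro sum.cong refl arg_cong2[where f = "(*)"] prod.cong)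
       (auto dest: permutes_in_image[THEN iffD2])
  finally show ?thesis .
qed

lemma alternant_cong:
  assumes "\<And>i j. i < n \<Longrightarrow> j < n \<Longrightarrow> f j (x i) = g j (y i)"
  shows "alternant n f x = alternant n g y"
  unfolding alternant_def by (intro arg_cong[where f = det] eq_matI) (auto simp: assms)

lemma alternant_permute:
  assumes "p permutes {0..<n}"
  shows "alternant n f (x \<circ> p) = signof p * alternant n f x"
proof -
  have "alternant n f (x \<circ> p) =
      det (mat n n (\<lambda>(i, j). mat n n (\<lambda>(i, j). f j (x i)) $$ (p i, j)))"
    unfolding alternant_def using permutes_in_image[OF assms]
    by (intro arg_cong[where f = det] eq_matI) auto
  also have "\<dots> = signof p * alternant n f x"
    unfolding alternant_def by (rule det_permute_rows[OF _ assms]) simp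
  finally show ?thesis .
qed

lemma alternant_repeated_node:
  assumes "\<not> inj_on x {0..<n}"
  shows "alternant n f x = 0"
proof -
  obtain i j where "i \<noteq> j" "i < n" "j < n" "x i = x j"
    using assms by (auto simp: inj_on_def)
  then show ?thesis
    unfolding alternant_def
    by (intro det_identical_rows[of _ n i j]) (auto intro!: eq_vecI)
qed

lemma alternant_scale:
  "alternant n (\<lambda>j y. c y * d j * f j y) x =
     (\<Prod>i = 0..<n. c (x i)) * (\<Prod>j = 0..<n. d j) * alternant n f x"
proof -
  have "(\<Prod>i = 0..<n. c (x i) * d (p i) * f (p i) (x i)) =
      (\<Prod>i = 0..<n. c (x i)) * (\<Prod>j = 0..<n. d j) * (\<Prod>i = 0..<n. f (p i) (x i))"
    if "p permutes {0..<n}" for p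
    using prod.permute[OF that, of d] by (simp add: prod.distrib o_def)
  then show ?thesis
    unfolding alternant_expand sum_distrib_left
    by (intro sum.cong refl) (auto simp: mult_ac)
qed

text \<open>
  Expanding every row of the determinant multilinearly gives the sum over all tuples \<open>x\<close> of
  \<open>\<Prod>\<^sub>i w(x\<^sub>i) f\<^sub>i(x\<^sub>i)\<close> times the alternant of \<open>g\<close> at \<open>x\<close>. The sum over all tuples does not
  change when the entries of each tuple are permuted by some \<open>p\<close>; this produces \<open>signof p\<close> from the
  alternant of \<open>g\<close>, and summing over the \<open>n!\<close> permutations assembles the alternant of \<open>f\<close>.
\<close>

lemma andreief_identity:
  fixes f g :: "nat \<Rightarrow> 'b \<Rightarrow> 'a :: comm_ring_1"
  assumes "finite Y"
  shows "of_nat (fact n) * det (mat n n (\<lambda>(i, j). \<Sum>y\<in>Y. w y * f i y * g j y)) =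
    (\<Sum>x \<in> {0..<n} \<rightarrow>\<^sub>E Y. (\<Prod>i = 0..<n. w (x i)) * alternant n f x * alternant n g x)"
proof -
  define P where "P = {p. p permutes {0..<n}}"
  define F where "F = {0..<n} \<rightarrow>\<^sub>E Y"
  define A where "A = mat n n (\<lambda>(i, j). \<Sum>y\<in>Y. w y * f i y * g j y)"
  define S where "S x = (\<Prod>i = 0..<n. w (x i)) * (\<Prod>i = 0..<n. f i (x i)) * alternant n g x" for x
  have det_A: "det A = (\<Sum>x\<in>F. S x)"
  proof -
    have "det A = (\<Sum>p\<in>P. signof p * (\<Prod>i = 0..<n. A $$ (i, p i)))"
      unfolding P_def A_def by (rule det_def') simp
    also have "\<dots> = (\<Sum>p\<in>P. signof p * (\<Prod>i = 0..<n. \<Sum>y\<in>Y. w y * f i y * g (p i) y))"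
      by (intro sum.cong refl arg_cong2[where f = "(*)"] prod.cong)
         (auto simp: P_def A_def dest: permutes_in_image[THEN iffD2])
    also have "\<dots> = (\<Sum>p\<in>P. \<Sum>x\<in>F. signof p *
        ((\<Prod>i = 0..<n. w (x i)) * (\<Prod>i = 0..<n. f i (x i)) * (\<Prod>i = 0..<n. g (p i) (x i))))"
      unfolding F_def using assms
      by (subst prod_sum_PiE) (auto simp: sum_distrib_left prod.distrib)
    also have "\<dots> = (\<Sum>x\<in>F. S x)"
      unfolding S_def alternant_expand P_def sum_distrib_left
      by (subst sum.swap) (simp add: mult_ac)
    finally show ?thesis .
  qed
  \<comment> \<open>Invariance of the sum under relabelling the nodes by \<open>p\<close>.\<close>
  have relabel: "(\<Sum>x\<in>F. S x) =
      (\<Sum>x\<in>F. (\<Prod>i = 0..<n. w (x i)) * (signof p * (\<Prod>i = 0..<n. f i (x (p i)))) * alternant n g x)"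
    if p: "p \<in> P" for p
  proof -
    have p: "p permutes {0..<n}" using p by (simp add: P_def)
    have *: "(\<lambda>x. x \<circ> q) \<in> F \<rightarrow> F" if "q permutes {0..<n}" for q
      using permutes_in_image[OF that] permutes_not_in[OF that]
      by (force simp: F_def PiE_def Pi_def extensional_def)
    have "(\<Sum>x\<in>F. S x) = (\<Sum>x\<in>F. S (x \<circ> p))"
      using *[OF p] *[OF permutes_inv[OF p]]
      by (intro sum.reindex_bij_witness[of _ "\<lambda>x. x \<circ> p" "\<lambda>x. x \<circ> Hilbert_Choice.inv p"])
         (auto simp: comp_assoc permutes_inv_o[OF p])
    moreover have "S (x \<circ> p) =
      (\<Prod>i = 0..<n. w (x i)) * (signof p * (\<Prod>i = 0..<n. f i (x (p i)))) * alternant n g x" for x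
      using prod.permute[OF p, of "\<lambda>i. w (x i)"]
      by (simp add: S_def alternant_permute[OF p, unfolded o_def] o_def mult_ac)
    ultimately show ?thesis by simp
  qed
  have "of_nat (fact n) * det A = (\<Sum>p\<in>P. \<Sum>x\<in>F. S x)"
    by (simp add: det_A P_def card_permutations[OF refl])
  also have "\<dots> = (\<Sum>p\<in>P. \<Sum>x\<in>F.
      (\<Prod>i = 0..<n. w (x i)) * (signof p * (\<Prod>i = 0..<n. f i (x (p i)))) * alternant n g x)"
    by (rule sum.cong[OF refl relabel])
  also have "\<dots> = (\<Sum>x\<in>F. (\<Prod>i = 0..<n. w (x i)) * alternant n f x * alternant n g x)"
    by (subst sum.swap)
       (simp add: alternant_expand_rows[of n f] P_def sum_distrib_left sum_distrib_right)
  finally show ?thesis by (simp add: A_def F_def)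
qed

lemma exists_sorting_permutation:
  fixes x :: "nat \<Rightarrow> 'b :: linorder"
  assumes "inj_on x {0..<n}"
  obtains p where "p permutes {0..<n}" "strict_mono_on {0..<n} (x \<circ> p)"
proof -
  define L where "L = sorted_list_of_set (x ` {0..<n})"
  define p where "p i = (if i < n then inv_into {0..<n} x (L ! i) else i)" for i
  have len: "length L = n" and set: "set L = x ` {0..<n}"
    using assms by (simp_all add: L_def card_image)
  have L: "L ! i \<in> x ` {0..<n}" if "i < n" for i
    using that len set nth_mem by metis
  have xp: "x (p i) = L ! i" if "i < n" for i
    using that L[OF that] by (simp add: p_def f_inv_into_f)
  have less: "L ! i < L ! j" if "i < j" "j < n" for i j
    using that len strict_sorted_list_of_set[of "x ` {0..<n}"]
    by (auto simp: L_def sorted_wrt_iff_nth_less)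
  have mono: "strict_mono_on {0..<n} (x \<circ> p)"
    by (auto simp: strict_mono_on_def xp less)
  have "p ` {0..<n} \<subseteq> {0..<n}"
    using inv_into_into[OF L] by (auto simp: p_def)
  moreover have "inj_on p {0..<n}"
    using strict_mono_on_imp_inj_on[OF mono] by (rule inj_on_imageI2)
  ultimately have "bij_betw p {0..<n} {0..<n}"
    by (simp add: bij_betw_def endo_inj_surj)
  then have "p permutes {0..<n}"
    by (rule bij_imp_permutes) (simp add: p_def)
  with mono show ?thesis using that by blast
qed

text \<open>
  The product of two alternants is a symmetric function of the nodes, so its sign may be determined
  at sorted nodes.
\<close>

lemma alternant_product_nonneg:
  fixes f g :: "nat \<Rightarrow> 'b :: linorder \<Rightarrow> real"
  assumes "\<And>y. strict_mono_on {0..<n} y \<Longrightarrow> 0 \<le> alternant n f y"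
    and "\<And>y. strict_mono_on {0..<n} y \<Longrightarrow> 0 \<le> alternant n g y"
  shows "0 \<le> alternant n f x * alternant n g x"
proof (cases "inj_on x {0..<n}")
  case True
  then obtain p where p: "p permutes {0..<n}" and mono: "strict_mono_on {0..<n} (x \<circ> p)"
    by (rule exists_sorting_permutation)
  have "0 \<le> alternant n f (x \<circ> p) * alternant n g (x \<circ> p)"
    using assms mono by simp
  also have "\<dots> = alternant n f x * alternant n g x"
    using signof_pm_one[of p, where ?'a = real] by (auto simp: alternant_permute[OF p])
  finally show ?thesis .
qed (simp add: alternant_repeated_node)

section \<open>Generalized Vandermonde determinants\<close>

text \<open>The coefficients are the cofactors along row \<open>k\<close>, which do not see the entries of that row.\<close>

lemma det_linear_in_row:
  fixes B :: "nat \<Rightarrow> nat \<Rightarrow> 'a :: comm_ring_1"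
  assumes "k < n"
  obtains C where
    "\<And>v. det (mat n n (\<lambda>(i, j). if i = k then v j else B i j)) = (\<Sum>j<n. v j * C j)"
proof
  fix v :: "nat \<Rightarrow> 'a"
  let ?M = "\<lambda>v. mat n n (\<lambda>(i, j). if i = k then v j else B i j)"
  have "mat_delete (?M v) k j = mat_delete (?M (B k)) k j" for j
    unfolding mat_delete_def using assms by (intro eq_matI) auto
  then have "cofactor (?M v) k j = cofactor (?M (B k)) k j" for j
    by (simp add: cofactor_def)
  then show "det (?M v) = (\<Sum>j<n. v j * cofactor (?M (B k)) k j)"
    using assms by (subst laplace_expansion_row[of _ n k]) auto
qed

text \<open>
  A mean value theorem for determinants: by linearity in a row, the mean value theorem replaces the
  increment of all \<open>f j\<close> over one interval by the derivatives of all \<open>f j\<close> at one common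
  intermediate point, up to the positive length of the interval. Doing so in one row after another
  leads to an alternant of the derivatives, at nodes that lie in the successive intervals.
\<close>

lemma det_increments_pos:
  fixes f f' :: "nat \<Rightarrow> real \<Rightarrow> real" and x :: "nat \<Rightarrow> real"
  assumes x: "\<And>i. i < n \<Longrightarrow> x i < x (Suc i)"
    and deriv: "\<And>j t. (f j has_real_derivative f' j t) (at t)"
    and pos: "\<And>t. (\<And>i. i < n \<Longrightarrow> x i < t i \<and> t i < x (Suc i)) \<Longrightarrow> 0 < alternant n f' t"
  shows "0 < det (mat n n (\<lambda>(i, j). f j (x (Suc i)) - f j (x i)))"
proof -
  \<comment> \<open>\<open>M k t\<close> has derivatives in its first \<open>k\<close> rows and increments below. Positivity is known
    for \<open>k = n\<close> and is carried down to \<open>k = 0\<close>.\<close>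
  define M where "M k t = mat n n (\<lambda>(i, j).
    if i < k then f' j (t i) else f j (x (Suc i)) - f j (x i))" for k and t :: "nat \<Rightarrow> real"
  have "\<forall>t. (\<forall>i<n. x i < t i \<and> t i < x (Suc i)) \<longrightarrow> 0 < det (M 0 t)"
  proof (rule inc_induct[of 0 n "\<lambda>k. \<forall>t. (\<forall>i<n. x i < t i \<and> t i < x (Suc i)) \<longrightarrow> 0 < det (M k t)"])
    have "M n t = mat n n (\<lambda>(i, j). f' j (t i))" for t
      unfolding M_def by (intro eq_matI) auto
    then show "\<forall>t. (\<forall>i<n. x i < t i \<and> t i < x (Suc i)) \<longrightarrow> 0 < det (M n t)"
      using pos by (auto simp: alternant_def)
  next
    fix k
    assume k: "k < n" and IH: "\<forall>t. (\<forall>i<n. x i < t i \<and> t i < x (Suc i)) \<longrightarrow> 0 < det (M (Suc k) t)"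
    show "\<forall>t. (\<forall>i<n. x i < t i \<and> t i < x (Suc i)) \<longrightarrow> 0 < det (M k t)"
    proof (intro allI impI)
      fix t assume t: "\<forall>i<n. x i < t i \<and> t i < x (Suc i)"
      obtain C where C: "\<And>v. det (mat n n (\<lambda>(i, j). if i = k then v j else
          if i < k then f' j (t i) else f j (x (Suc i)) - f j (x i))) = (\<Sum>j<n. v j * C j)"
        by (rule det_linear_in_row[OF k, of "\<lambda>i j.
          if i < k then f' j (t i) else f j (x (Suc i)) - f j (x i)"]) blast
      define g where "g s = (\<Sum>j<n. f j s * C j)" for s
      have "DERIV g s :> (\<Sum>j<n. f' j s * C j)" for s
        unfolding g_def by (intro DERIV_sum DERIV_cmult_right deriv)
      then obtain z where z: "x k < z" "z < x (Suc k)"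
        and diff: "g (x (Suc k)) - g (x k) = (x (Suc k) - x k) * (\<Sum>j<n. f' j z * C j)"
        using MVT2[OF x[OF k], of g "\<lambda>s. \<Sum>j<n. f' j s * C j"] by blast
      have "M (Suc k) (t(k := z)) = mat n n (\<lambda>(i, j). if i = k then f' j z else
          if i < k then f' j (t i) else f j (x (Suc i)) - f j (x i))"
        unfolding M_def by (intro eq_matI) auto
      then have "det (M (Suc k) (t(k := z))) = (\<Sum>j<n. f' j z * C j)"
        using C[of "\<lambda>j. f' j z"] by simp
      moreover have "0 < det (M (Suc k) (t(k := z)))"
        using IH t z by simp
      moreover have "M k t = mat n n (\<lambda>(i, j). if i = k then f j (x (Suc k)) - f j (x k) else
          if i < k then f' j (t i) else f j (x (Suc i)) - f j (x i))"
        unfolding M_def by (intro eq_matI) auto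
      then have "det (M k t) = g (x (Suc k)) - g (x k)"
        using C[of "\<lambda>j. f j (x (Suc k)) - f j (x k)"]
        by (simp add: g_def sum_subtractf left_diff_distrib)
      ultimately show "0 < det (M k t)"
        using diff x[OF k] by simp
    qed
  qed simp
  \<comment> \<open>\<open>M 0 t\<close> does not depend on \<open>t\<close>; midpoints are one admissible choice.\<close>
  from this[rule_format, of "\<lambda>i. (x i + x (Suc i)) / 2"] x show ?thesis
    by (simp add: M_def)
qed

text \<open>
  Subtracting from every row the one above it leaves a first column with the single entry 1 at the
  top. The row operation is multiplication by the unit lower bidiagonal matrix \<open>T\<close>.
\<close>

lemma alternant_differences:
  fixes f :: "nat \<Rightarrow> 'b \<Rightarrow> 'a :: comm_ring_1"
  assumes "\<And>y. f 0 y = 1"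
  shows "alternant (Suc n) f x =
    det (mat n n (\<lambda>(i, j). f (Suc j) (x (Suc i)) - f (Suc j) (x i)))"
proof -
  let ?N = "Suc n"
  define A where "A = mat ?N ?N (\<lambda>(i, j). f j (x i))"
  define T :: "'a mat" where
    "T = mat ?N ?N (\<lambda>(i, j). if i = j then 1 else if i = Suc j then -1 else 0)"
  define D where "D = mat ?N ?N (\<lambda>(i, j). case i of 0 \<Rightarrow> f j (x 0) | Suc m \<Rightarrow> f j (x i) - f j (x m))"
  have carrier: "A \<in> carrier_mat ?N ?N" "T \<in> carrier_mat ?N ?N" "D \<in> carrier_mat ?N ?N"
    by (simp_all add: A_def T_def D_def)
  have "T * A = D"
  proof (rule eq_matI)
    fix i j assume "i < dim_row D" "j < dim_col D"
    then have ij: "i < ?N" "j < ?N" by (simp_all add: D_def)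
    have "(T * A) $$ (i, j) =
        (\<Sum>k = 0..<?N. (if i = k then 1 else if i = Suc k then -1 else 0) * f j (x k))"
      using ij by (simp add: T_def A_def scalar_prod_def)
    also have "\<dots> = (\<Sum>k = 0..<?N. (if k = i then f j (x k) else 0) -
        (if Suc k = i then f j (x k) else 0))"
      by (intro sum.cong) auto
    also have "\<dots> = D $$ (i, j)"
      using ij by (cases i) (auto simp: D_def sum_subtractf sum.delta)
    finally show "(T * A) $$ (i, j) = D $$ (i, j)" .
  qed (simp_all add: A_def T_def D_def)
  moreover have "det T = 1"
    by (subst det_lower_triangular[of ?N]) (auto simp: T_def prod_list_diag_prod)
  ultimately have "det A = det D"
    using det_mult[OF carrier(2,1)] by simp
  also have "\<dots> = (\<Sum>i<?N. D $$ (i, 0) * cofactor D i 0)"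
    by (rule laplace_expansion_column[OF carrier(3)]) simp
  also have "\<dots> = (\<Sum>i<?N. if i = 0 then cofactor D 0 0 else 0)"
    by (intro sum.cong) (auto simp: D_def assms split: nat.splits)
  also have "\<dots> = det (mat_delete D 0 0)"
    by (simp add: cofactor_def)
  also have "mat_delete D 0 0 = mat n n (\<lambda>(i, j). f (Suc j) (x (Suc i)) - f (Suc j) (x i))"
    by (intro eq_matI) (auto simp: mat_delete_def D_def)
  finally show ?thesis by (simp add: alternant_def A_def)
qed

lemma alternant_powers_factor:
  fixes x :: "nat \<Rightarrow> real" and a :: "nat \<Rightarrow> nat"
  assumes "\<And>j. j < n \<Longrightarrow> c \<le> a j"
  shows "alternant n (\<lambda>j y. y ^ a j) x =
    (\<Prod>i = 0..<n. x i ^ c) * alternant n (\<lambda>j y. y ^ (a j - c)) x"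
proof -
  have "alternant n (\<lambda>j y. y ^ a j) x = alternant n (\<lambda>j y. y ^ c * 1 * y ^ (a j - c)) x"
    using assms by (intro alternant_cong) (simp flip: power_add)
  then show ?thesis
    by (simp only: alternant_scale) simp
qed

text \<open>
  The classical induction behind the strict total positivity of the kernel \<open>x\<^sup>a\<close>: extracting the
  smallest power from every row makes the first column constant, so that row differences reduce the
  size by one, and \<open>det_increments_pos\<close> passes to the derivatives, which are again powers up to
  positive factors, at nodes interlacing the given ones. The smallest node may be 0 if the smallest
  exponent is 0; as the new nodes lie strictly above the smallest one, they are positive in any case.
\<close>

theorem alternant_powers_pos:
  fixes x :: "nat \<Rightarrow> real" and a :: "nat \<Rightarrow> nat"
  assumes "strict_mono_on {0..<n} a" and "strict_mono_on {0..<n} x"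
    and "n > 0 \<Longrightarrow> 0 < x 0 \<or> x 0 = 0 \<and> a 0 = 0"
  shows "0 < alternant n (\<lambda>j y. y ^ a j) x"
  using assms
proof (induction n arbitrary: a x)
  case 0
  then show ?case by (simp add: alternant_def)
next
  case (Suc n)
  have a: "a i < a j" if "i < j" "j \<le> n" for i j
    using Suc.prems(1) that by (auto simp: strict_mono_on_def)
  have x: "x i < x j" if "i < j" "j \<le> n" for i j
    using Suc.prems(2) that by (auto simp: strict_mono_on_def)
  have a0: "a 0 \<le> a j" if "j \<le> n" for j
    using a[of 0 j] that by (cases j) auto
  define b where "b j = a j - a 0" for j
  have b: "b i < b j" if "i < j" "j \<le> n" for i j
    using a[OF that] a0[of i] that by (simp add: b_def)
  define f' where "f' j t = real (b (Suc j)) * t ^ (b (Suc j) - 1)" for j t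
  have "0 < alternant n f' t" if t: "\<And>i. i < n \<Longrightarrow> x i < t i \<and> t i < x (Suc i)" for t
  proof -
    have "strict_mono_on {0..<n} t"
    proof (rule strict_mono_onI)
      fix i j assume ij: "i \<in> {0..<n}" "j \<in> {0..<n}" "i < j"
      have "t i < x (Suc i)" using t ij by simp
      also have "x (Suc i) \<le> x j" using x[of "Suc i" j] ij by (cases "Suc i = j") auto
      also have "x j < t j" using t ij by simp
      finally show "t i < t j" .
    qed
    moreover have "strict_mono_on {0..<n} (\<lambda>j. b (Suc j) - 1)"
    proof (rule strict_mono_onI)
      fix i j assume ij: "i \<in> {0..<n}" "j \<in> {0..<n}" "i < j"
      then show "b (Suc i) - 1 < b (Suc j) - 1"
        using b[of "Suc i" "Suc j"] b[of 0 "Suc i"] by simp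
    qed
    moreover have "0 < t 0" if "n > 0"
      using Suc.prems(3) t[OF that] by auto
    ultimately have "0 < alternant n (\<lambda>j y. y ^ (b (Suc j) - 1)) t"
      by (intro Suc.IH) auto
    moreover have "0 < (\<Prod>j = 0..<n. real (b (Suc j)))"
    proof (rule prod_pos)
      fix j assume "j \<in> {0..<n}"
      then show "0 < real (b (Suc j))" using b[of 0 "Suc j"] by simp
    qed
    moreover have "alternant n f' t =
        (\<Prod>j = 0..<n. real (b (Suc j))) * alternant n (\<lambda>j y. y ^ (b (Suc j) - 1)) t"
      using alternant_scale[of n "\<lambda>_. 1" "\<lambda>j. real (b (Suc j))" "\<lambda>j y. y ^ (b (Suc j) - 1)" t]
      by (simp add: f'_def[abs_def])
    ultimately show ?thesis by simp
  qed
  moreover have "((\<lambda>y. y ^ b (Suc j)) has_real_derivative f' j t) (at t)" for j t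
    unfolding f'_def by (auto intro!: derivative_eq_intros)
  ultimately have
    "0 < det (mat n n (\<lambda>(i, j). x (Suc i) ^ b (Suc j) - x i ^ b (Suc j)))"
    using x by (intro det_increments_pos[of n x "\<lambda>j y. y ^ b (Suc j)" f']) auto
  then have "0 < alternant (Suc n) (\<lambda>j y. y ^ b j) x"
    by (subst alternant_differences) (auto simp: b_def)
  moreover have "0 < (\<Prod>i = 0..<Suc n. x i ^ a 0)"
  proof (cases "a 0 = 0")
    case False
    then have "0 < x i" if "i \<le> n" for i
      using Suc.prems(3) x[of 0 i] that by (cases i) auto
    then show ?thesis by (intro prod_pos) auto
  qed simp
  ultimately show ?case
    using alternant_powers_factor[of "Suc n" "a 0" a x] a0 by (simp add: b_def)
qed

text \<open>
  Once the smallest power is extracted, the remaining alternant is positive even if the first node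
  is 0; only the extracted factor can vanish.
\<close>

corollary alternant_powers_nonneg:
  fixes x :: "nat \<Rightarrow> real" and a :: "nat \<Rightarrow> nat"
  assumes "strict_mono_on {0..<n} a" and "strict_mono_on {0..<n} x"
    and "\<And>i. i < n \<Longrightarrow> 0 \<le> x i"
  shows "0 \<le> alternant n (\<lambda>j y. y ^ a j) x"
proof (cases "n = 0")
  case False
  have a0: "a 0 \<le> a j" if "j < n" for j
    using assms(1) that by (cases j) (auto simp: strict_mono_on_def intro: less_imp_le)
  have "strict_mono_on {0..<n} (\<lambda>j. a j - a 0)"
    using assms(1) a0 by (auto simp: strict_mono_on_def intro!: diff_less_mono)
  then have "0 < alternant n (\<lambda>j y. y ^ (a j - a 0)) x"
    using assms(2) assms(3)[of 0] False by (intro alternant_powers_pos) auto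
  moreover have "0 \<le> (\<Prod>i = 0..<n. x i ^ a 0)"
    using assms(3) by (intro prod_nonneg) auto
  ultimately show ?thesis
    using alternant_powers_factor[of n "a 0" a x] a0 by simp
qed (simp add: alternant_def)

section \<open>Bell numbers as moments of the Poisson distribution\<close>

text \<open>
  This is the expansion of \<open>k\<^sup>m\<close> into falling factorials, divided by \<open>k!\<close>; the factor
  \<open>1 / (k - j)!\<close> is the \<open>j\<close>th falling factorial of \<open>k\<close> over \<open>k!\<close>.
\<close>

lemma power_eq_sum_Stirling_div_fact:
  "real k ^ m / fact k =
     (\<Sum>j\<le>m. real (Stirling m j) * (if j \<le> k then 1 / fact (k - j) else 0))"
proof (induction m)
  case 0
  then show ?case by simp
next
  case (Suc m)
  define g :: "nat \<Rightarrow> real" where "g j = (if j \<le> k then 1 / fact (k - j) else 0)" for j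
  \<comment> \<open>The recurrence of falling factorials that matches the one of the Stirling numbers.\<close>
  have g: "real k * g j = g (Suc j) + real j * g j" for j
  proof -
    consider "k < j" | "k = j" | d where "k = Suc (j + d)"
      by (metis less_iff_Suc_add linorder_neqE_nat)
    then show ?thesis
    proof cases
      case 3
      have "real k * g j = (real j + real (Suc d)) / fact (Suc d)"
        using 3 by (simp add: g_def)
      also have "\<dots> = g (Suc j) + real j * g j"
        using 3 by (simp add: g_def add_divide_distrib[symmetric] divide_simps)
      finally show ?thesis .
    qed (auto simp: g_def)
  qed
  have "real k ^ Suc m / fact k = real k * (\<Sum>j\<le>m. real (Stirling m j) * g j)"
    by (simp add: g_def flip: Suc.IH)
  also have "\<dots> = (\<Sum>j\<le>m. real (Stirling m j) * (real k * g j))"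
    by (simp add: sum_distrib_left mult_ac)
  also have "\<dots> = (\<Sum>j\<le>m. real (Stirling m j) * g (Suc j)) +
      (\<Sum>j\<le>m. real j * real (Stirling m j) * g j)"
    by (simp add: g distrib_left sum.distrib mult_ac)
  also have "(\<Sum>j\<le>m. real j * real (Stirling m j) * g j) =
      (\<Sum>j\<le>Suc m. real j * real (Stirling m j) * g j)"
    by simp
  also have "\<dots> = (\<Sum>j\<le>m. real (Suc j) * real (Stirling m (Suc j)) * g (Suc j))"
    by (subst sum.atMost_Suc_shift) simp
  also have "(\<Sum>j\<le>m. real (Stirling m j) * g (Suc j)) + \<dots> =
      (\<Sum>j\<le>m. real (Stirling (Suc m) (Suc j)) * g (Suc j))"
    by (simp add: distrib_right sum.distrib)
  also have "\<dots> = (\<Sum>j\<le>Suc m. real (Stirling (Suc m) j) * g j)"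
    by (subst sum.atMost_Suc_shift) simp
  finally show ?case by (simp add: g_def)
qed

text \<open>
  In the expansion into falling factorials, each of them contributes a shifted exponential series
  with sum \<open>e\<close>.
\<close>

theorem dobinski: "(\<lambda>k. exp (-1) / fact k * real k ^ m) sums real (bell m)"
proof -
  have shifted: "(\<lambda>k. if j \<le> k then 1 / fact (k - j) else 0) sums exp (1 :: real)" for j
  proof -
    have "(\<lambda>k. if j \<le> k + j then 1 / fact (k + j - j) else 0) sums exp (1 :: real)"
      using exp_converges[of "1 :: real"] by (simp add: field_simps)
    then show ?thesis
      by (subst (asm) sums_zero_iff_shift) auto
  qed
  have "(\<lambda>k. \<Sum>j\<le>m. real (Stirling m j) * (if j \<le> k then 1 / fact (k - j) else 0))
      sums (\<Sum>j\<le>m. real (Stirling m j) * exp 1)"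
    by (intro sums_sum sums_mult shifted)
  then have "(\<lambda>k. real k ^ m / fact k) sums (\<Sum>j\<le>m. real (Stirling m j) * exp 1)"
    by (simp only: power_eq_sum_Stirling_div_fact)
  then have "(\<lambda>k. real k ^ m / fact k) sums (real (bell m) * exp 1)"
    by (simp add: bell_def sum_distrib_right)
  from sums_mult[OF this, of "exp (-1)"] show ?thesis
    by (simp add: exp_minus field_simps)
qed

section \<open>Positivity of the minors\<close>

lemma tendsto_det:
  fixes A :: "'c \<Rightarrow> nat \<Rightarrow> nat \<Rightarrow> real"
  assumes "\<And>i j. i < n \<Longrightarrow> j < n \<Longrightarrow> ((\<lambda>N. A N i j) \<longlongrightarrow> B i j) F"
  shows "((\<lambda>N. det (mat n n (\<lambda>(i, j). A N i j))) \<longlongrightarrow> det (mat n n (\<lambda>(i, j). B i j))) F"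
proof -
  have "det (mat n n (\<lambda>(i, j). M i j)) =
      (\<Sum>p | p permutes {0..<n}. signof p * (\<Prod>i = 0..<n. M i (p i)))" for M :: "nat \<Rightarrow> nat \<Rightarrow> real"
    by (subst det_def'[of _ n]) (auto intro!: sum.cong prod.cong dest: permutes_in_image[THEN iffD2])
  then show ?thesis
    by (auto intro!: tendsto_intros assms dest: permutes_in_image[THEN iffD2])
qed

text \<open>
  In the proof, \<open>W x\<close> is the contribution of the nodes \<open>x\<close> to \<open>n!\<close> times the truncated
  determinant. The nodes \<open>1, \<dots>, n\<close> provide the lower bound that survives the limit; starting at 0
  would not do, since the powers of 0 make the alternant vanish when all exponents are positive.
\<close>

lemma bell_minor_pos:
  fixes a b :: "nat \<Rightarrow> nat"
  assumes a: "strict_mono_on {0..<n} a" and b: "strict_mono_on {0..<n} b"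
  shows "0 < det (mat n n (\<lambda>(i, j). real (bell (a i + b j))))"
proof -
  define w :: "nat \<Rightarrow> real" where "w k = exp (-1) / fact k" for k
  define f where "f c j k = real k ^ c j" for c :: "nat \<Rightarrow> nat" and j k :: nat
  define A where "A N i j = (\<Sum>k<N. w k * f a i k * f b j k)" for N i j
  define B where "B = mat n n (\<lambda>(i, j). real (bell (a i + b j)))"
  define W where "W x = (\<Prod>i = 0..<n. w (x i)) * alternant n (f a) x * alternant n (f b) x" for x
  have alternant_f: "alternant n (f c) x = alternant n (\<lambda>j y. y ^ c j) (\<lambda>i. real (x i))" for c x
    by (simp add: alternant_def f_def)
  have w: "0 < w k" for k by (simp add: w_def)
  have "(\<lambda>N. det (mat n n (\<lambda>(i, j). A N i j))) \<longlonglongrightarrow> det B"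
    unfolding B_def
  proof (rule tendsto_det)
    fix i j
    show "(\<lambda>N. A N i j) \<longlonglongrightarrow> real (bell (a i + b j))"
      using dobinski[of "a i + b j"]
      by (simp add: sums_def A_def w_def f_def power_add mult_ac)
  qed
  then have lim: "(\<lambda>N. fact n * det (mat n n (\<lambda>(i, j). A N i j))) \<longlonglongrightarrow> fact n * det B"
    by (intro tendsto_intros)
  have nonneg: "0 \<le> W x" for x
  proof -
    have "0 \<le> alternant n (f c) y" if "strict_mono_on {0..<n} c" "strict_mono_on {0..<n} y" for c y
      unfolding alternant_f using that
      by (intro alternant_powers_nonneg) (auto simp: strict_mono_on_def)
    then have "0 \<le> alternant n (f a) x * alternant n (f b) x"
      using a b by (intro alternant_product_nonneg) auto
    moreover have "0 \<le> (\<Prod>i = 0..<n. w (x i))"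
      by (intro prod_nonneg) (simp add: w less_imp_le)
    ultimately show ?thesis by (simp add: W_def mult.assoc)
  qed
  define x where "x = restrict Suc {0..<n}"
  have "0 < alternant n (f c) x" if "strict_mono_on {0..<n} c" for c
    unfolding alternant_f using that
    by (intro alternant_powers_pos) (auto simp: strict_mono_on_def x_def)
  then have pos: "0 < W x"
    using a b unfolding W_def by (intro mult_pos_pos prod_pos) (auto simp: w)
  have "W x \<le> fact n * det (mat n n (\<lambda>(i, j). A N i j))" if "n < N" for N
  proof -
    have "W x \<le> (\<Sum>x \<in> {0..<n} \<rightarrow>\<^sub>E {..<N}. W x)"
      using that by (intro member_le_sum nonneg) (auto simp: x_def intro!: finite_PiE)
    then show ?thesis
      using andreief_identity[of "{..<N}" n w "f a" "f b"] by (simp add: A_def W_def)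
  qed
  then have "\<forall>\<^sub>F N in sequentially. W x \<le> fact n * det (mat n n (\<lambda>(i, j). A N i j))"
    using eventually_gt_at_top[of n] by (rule eventually_mono[rotated])
  then have "W x \<le> fact n * det B"
    using lim by (intro tendsto_lowerbound) auto
  with pos have "0 < fact n * det B" by linarith
  then show ?thesis by (simp add: zero_less_mult_iff B_def)
qed

theorem theorem3p5:
  fixes n :: nat
  assumes "n > 0"
  shows "totally_positive (bell_matrix n)"
  unfolding totally_positive_def
proof (intro allI impI, elim conjE)
  fix I J
  assume I: "I \<subseteq> {..<dim_row (bell_matrix n)}" and J: "J \<subseteq> {..<dim_col (bell_matrix n)}"
    and card: "card I = card J"
  let ?p = "card I"
  have IJ: "I \<subseteq> {..<n}" "J \<subseteq> {..<n}" using I J by (simp_all add: bell_matrix_def)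
  then have rows: "{i. i < n \<and> i \<in> I} = I" and cols: "{j. j < n \<and> j \<in> J} = J" by auto
  have in_bounds: "pick I i < n" "pick J i < n" if "i < ?p" for i
    using pick_in_set_le[of i I] pick_in_set_le[of i J] that card IJ by auto
  have "submatrix (bell_matrix n) I J =
      mat ?p ?p (\<lambda>(i, j). real (bell (pick I i + pick J j)))"
    using card in_bounds by (intro eq_matI) (auto simp: submatrix_def bell_matrix_def rows cols)
  moreover have "strict_mono_on {0..<?p} (pick I)" "strict_mono_on {0..<?p} (pick J)"
    using card by (auto simp: strict_mono_on_def intro: pick_mono_le)
  ultimately show "0 < det (submatrix (bell_matrix n) I J)"
    by (simp add: bell_minor_pos)
qed

end
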